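(* Let $H_3$ be the Heisenberg group over $\mathbb Z_3$, i.e. $\{x^ay^bz^c:0\le a,b,c<3\}$ with relations $x^3=y^3=z^3=1$, $xz=zx$, $yz=zy$, $yx=xyz$. Let $\mathscr S(H_3)$ be the set of integer group determinants $\det(a_{gh^{-1}})_{g,h\in H_3}$ with all $a_g\in\mathbb Z$, and let $\mathscr S_1(H_3)$, resp. $\mathscr S_0(H_3)$, be the elements of $\mathscr S(H_3)$ not divisible, resp. divisible, by $3$. Then $$\mathscr S_1(H_3)=\{m\in\mathbb Z: m\equiv\pm1\pmod{27}\},\qquad \mathscr S_0(H_3)=3^{12}\mathbb Z.$$ *)

theory Defs
  imports
    "HOL-Analysis.Determinants"
    "HOL-Library.Numeral_Type"
    "HOL-Algebra.Group"
    "HOL-Number_Theory.Cong"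
begin

text \<open>
  The numeral type \<open>3\<close> is the ring of integers modulo 3.  The triple \<open>(a, b, c)\<close> stands for
  the normal form \<open>x\<^sup>a y\<^sup>b z\<^sup>c\<close>; since \<open>y x = x y z\<close> with \<open>z\<close> central, moving
  \<open>y\<^sup>b\<close> past \<open>x\<^sup>a\<^sup>'\<close> contributes the factor \<open>z\<^bsup>b a'\<^esup>\<close>.
\<close>

definition H3 :: "(3 \<times> 3 \<times> 3) monoid" where
  "H3 = \<lparr>carrier = UNIV,
         mult = (\<lambda>(a, b, c) (a', b', c'). (a + a', b + b', c + c' + b * a')),
         one = (0, 0, 0)\<rparr>"

text \<open>
  The matrix is indexed by the whole finite type \<open>'g\<close>, so the following two definitions are meant
  for groups with \<open>carrier G = UNIV\<close>.
\<close>

definition group_det :: "('g::finite) monoid \<Rightarrow> ('g \<Rightarrow> int) \<Rightarrow> int" where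
  "group_det G a = det (\<chi> g h. a (g \<otimes>\<^bsub>G\<^esub> inv\<^bsub>G\<^esub> h))"

definition integer_group_dets :: "('g::finite) monoid \<Rightarrow> int set" where
  "integer_group_dets G = {group_det G a | a. True}"

definition S1 :: "('g::finite) monoid \<Rightarrow> int set" where
  "S1 G = {m \<in> integer_group_dets G. \<not> 3 dvd m}"

definition S0 :: "('g::finite) monoid \<Rightarrow> int set" where
  "S0 G = {m \<in> integer_group_dets G. 3 dvd m}"

text \<open>
  The facts below show that \<^const>\<open>H3\<close> is a group of order 27 with elements \<open>x, y, z\<close> satisfying the
  defining relations, and that every element has a unique normal form \<open>x\<^sup>a y\<^sup>b z\<^sup>c\<close>.
\<close>

definition H3_x :: "3 \<times> 3 \<times> 3" where "H3_x = (1, 0, 0)"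
definition H3_y :: "3 \<times> 3 \<times> 3" where "H3_y = (0, 1, 0)"
definition H3_z :: "3 \<times> 3 \<times> 3" where "H3_z = (0, 0, 1)"

lemma carrier_H3 [simp]: "carrier H3 = UNIV"
  by (simp add: H3_def)

lemma one_H3: "\<one>\<^bsub>H3\<^esub> = (0, 0, 0)"
  by (simp add: H3_def)

lemma mult_H3: "(a, b, c) \<otimes>\<^bsub>H3\<^esub> (a', b', c') = (a + a', b + b', c + c' + b * a')"
  by (simp add: H3_def)

lemma group_H3: "group H3"
proof (rule groupI)
  fix g :: "3 \<times> 3 \<times> 3"
  obtain a b c where g: "g = (a, b, c)" by (cases g)
  have "(- a, - b, - c + a * b) \<otimes>\<^bsub>H3\<^esub> g = \<one>\<^bsub>H3\<^esub>"
    by (simp add: g mult_H3 one_H3 algebra_simps)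
  then show "\<exists>h\<in>carrier H3. h \<otimes>\<^bsub>H3\<^esub> g = \<one>\<^bsub>H3\<^esub>" by auto
qed (auto simp: mult_H3 one_H3 algebra_simps)

lemma card_carrier_H3: "card (carrier H3) = 27"
  by (simp add: card_cartesian_product flip: UNIV_Times_UNIV)

lemma pow_H3_x: "H3_x [^]\<^bsub>H3\<^esub> (n::nat) = (of_nat n, 0, 0)"
  by (induction n) (simp_all add: H3_x_def mult_H3 one_H3 nat_pow_def add.commute)

lemma pow_H3_y: "H3_y [^]\<^bsub>H3\<^esub> (n::nat) = (0, of_nat n, 0)"
  by (induction n) (simp_all add: H3_y_def mult_H3 one_H3 nat_pow_def add.commute)

lemma pow_H3_z: "H3_z [^]\<^bsub>H3\<^esub> (n::nat) = (0, 0, of_nat n)"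
  by (induction n) (simp_all add: H3_z_def mult_H3 one_H3 nat_pow_def add.commute)

lemma H3_relations:
  "H3_x [^]\<^bsub>H3\<^esub> (3::nat) = \<one>\<^bsub>H3\<^esub>"
  "H3_y [^]\<^bsub>H3\<^esub> (3::nat) = \<one>\<^bsub>H3\<^esub>"
  "H3_z [^]\<^bsub>H3\<^esub> (3::nat) = \<one>\<^bsub>H3\<^esub>"
  "H3_x \<otimes>\<^bsub>H3\<^esub> H3_z = H3_z \<otimes>\<^bsub>H3\<^esub> H3_x"
  "H3_y \<otimes>\<^bsub>H3\<^esub> H3_z = H3_z \<otimes>\<^bsub>H3\<^esub> H3_y"
  "H3_y \<otimes>\<^bsub>H3\<^esub> H3_x = H3_x \<otimes>\<^bsub>H3\<^esub> H3_y \<otimes>\<^bsub>H3\<^esub> H3_z"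
  unfolding pow_H3_x pow_H3_y pow_H3_z
  by (simp_all add: one_H3 mult_H3 H3_x_def H3_y_def H3_z_def)

lemma H3_normal_form:
  "bij_betw (\<lambda>(a, b, c). H3_x [^]\<^bsub>H3\<^esub> a \<otimes>\<^bsub>H3\<^esub> H3_y [^]\<^bsub>H3\<^esub> b \<otimes>\<^bsub>H3\<^esub> H3_z [^]\<^bsub>H3\<^esub> c)
     ({..<3::nat} \<times> {..<3::nat} \<times> {..<3::nat}) (carrier H3)"
proof -
  let ?A = "{..<3::nat} \<times> {..<3::nat} \<times> {..<3::nat}"
  let ?f = "\<lambda>(a, b, c). (of_nat a, of_nat b, of_nat c) :: 3 \<times> 3 \<times> 3"
  have rep: "\<exists>n<3. a = of_nat n" for a :: 3
  proof -
    have "a = of_nat 1 \<or> a = of_nat 2 \<or> a = of_nat 0"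
      using exhaust_3[of a] by auto
    then show ?thesis by (metis lessThan_iff numeral_3_eq_3 zero_less_Suc lessI less_SucI numeral_2_eq_2 One_nat_def)
  qed
  have "g \<in> ?f ` ?A" for g
  proof -
    obtain a b c where g: "g = (a, b, c)" by (cases g)
    obtain i j k where "i < 3" "j < 3" "k < 3" "a = of_nat i" "b = of_nat j" "c = of_nat k"
      using rep by metis
    then show ?thesis unfolding g by (intro image_eqI[of _ _ "(i, j, k)"]) auto
  qed
  then have im: "?f ` ?A = UNIV" by auto
  have "card (?f ` ?A) = card ?A"
    unfolding im using card_carrier_H3 by (simp add: card_cartesian_product)
  then have "inj_on ?f ?A" by (intro eq_card_imp_inj_on) auto
  with im have "bij_betw ?f ?A (carrier H3)" by (simp add: bij_betw_def)
  then show ?thesis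
    by (simp add: pow_H3_x pow_H3_y pow_H3_z mult_H3 case_prod_unfold)
qed

end

(*
  Over the complex numbers the regular representation of H3 is the sum of the representations rho
  k s induced from the nine characters of the abelian subgroup generated by x and z.  Those with k
  = 0 factor through Z3 x Z3, with coefficients b(i,j) = sum_c a(i,j,c), and contribute an integer
  P; those with k = 1, 2 contribute (d * cnj d)^3 for one Eisenstein integer d.  Modulo 3 (1 -
  omega), d is the integer n = (sum of the b(i,j)^3) - 3 (sum over the 12 affine lines of the
  product of the b(i,j) on it), so that the norm of d is n^2 modulo 9.  Put s = sum of all
  coefficients and n = s^3 + 3 X.  Then P = s^9 + 9 s^6 X modulo 27, the group determinant is
  therefore s^27 modulo 27, and this settles the case that 3 does not divide s.  If 3 divides s,
  then 9 divides the norm of d, and 3^6 divides P: all eight nontrivial characters of Z3 x Z3 take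
  values in the prime ideal over 3, and two conjugate ones are even divisible by 3.  Conversely,
  adding m to every coefficient changes the determinant only through s, by 27 m, so a few explicit
  elements suffice.
*)
theory Submission
  imports Defs
begin

subsection \<open>Block diagonal determinants\<close>

text \<open>In the Leibniz expansion a permutation that moves a point outside block \<open>i\<close>
  meets a zero entry. The remaining ones are the permutations of the block, and transport along
  \<open>j \<mapsto> (i, j)\<close> preserves their signs.\<close>

lemma det_block_single:
  fixes B :: "'a::comm_ring_1^'n^'n" and i :: "'i::finite"
  shows "det (\<chi> g h. if fst g = i \<and> fst h = i then B $ snd g $ snd h
                  else if g = h then 1 else 0 :: 'a^('i \<times> 'n)^('i \<times> 'n)) = det B"
    (is "det ?E = _")
proof -
  let ?U = "UNIV :: ('i \<times> 'n) set" and ?V = "UNIV :: 'n set" and ?S = "{i} \<times> (UNIV :: 'n set)"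
  let ?f = "\<lambda>j::'n. (i, j)"
  have bij: "bij_betw ?f ?V ?S" by (auto simp: bij_betw_def inj_on_def)
  have img: "?f ` ?V = ?S" by auto
  \<comment> \<open>Unfolding shows that \<open>map_permutation\<close> is conjugation by
    \<open>?f\<close> extended by the identity, the form in which
    \<open>bij_betw_permutations\<close> gives the bijection.\<close>
  have "map_permutation ?V ?f = (\<lambda>q g. if g \<in> ?S then ?f (q (inv_into ?V ?f g)) else g)"
    by (rule ext)+ (simp add: map_permutation_def restrict_id_def img)
  then have bij_perm: "bij_betw (map_permutation ?V ?f) {q. q permutes ?V} {p. p permutes ?S}"
    using bij_betw_permutations[OF bij] by simp
  have "det ?E = (\<Sum>p | p permutes ?S. of_int (sign p) * (\<Prod>g\<in>?U. ?E $ g $ p g))"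
    unfolding det_def
  proof (rule sum.mono_neutral_right)
    show "\<forall>p \<in> {p. p permutes ?U} - {p. p permutes ?S}.
        of_int (sign p) * (\<Prod>g\<in>?U. ?E $ g $ p g) = 0"
    proof
      fix p assume p: "p \<in> {p. p permutes ?U} - {p. p permutes ?S}"
      then obtain g where "g \<notin> ?S" "p g \<noteq> g"
        unfolding permutes_def by blast
      then have "?E $ g $ p g = 0" by (cases g) auto
      then have "(\<Prod>g\<in>?U. ?E $ g $ p g) = 0" by (intro prod_zero bexI[of _ g]) auto
      then show "of_int (sign p) * (\<Prod>g\<in>?U. ?E $ g $ p g) = 0" by simp
    qed
  qed (auto intro: permutes_subset)
  also have "\<dots> = (\<Sum>q | q permutes ?V. of_int (sign (map_permutation ?V ?f q)) *
      (\<Prod>g\<in>?U. ?E $ g $ map_permutation ?V ?f q g))"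
    by (rule sum.reindex_bij_betw [OF bij_perm, symmetric])
  also have "\<dots> = det B"
    unfolding det_def
  proof (rule sum.cong[OF refl])
    fix q assume q: "q \<in> {q. q permutes ?V}"
    let ?p = "map_permutation ?V ?f q"
    have pf: "?p (i, j) = (i, q j)" for j
      using map_permutation_apply[of ?f ?V j q] bij by (simp add: bij_betw_def)
    have perm: "?p permutes ?S" using q bij by (auto intro: map_permutation_permutes)
    have "(\<Prod>g\<in>?U. ?E $ g $ ?p g) = (\<Prod>g\<in>?S. ?E $ g $ ?p g)"
    proof (rule prod.mono_neutral_right)
      show "\<forall>g\<in>?U - ?S. ?E $ g $ ?p g = 1"
        using permutes_not_in[OF perm] by (auto split: prod.splits)
    qed auto
    also have "\<dots> = (\<Prod>j\<in>?V. ?E $ (i, j) $ ?p (i, j))"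
      using prod.reindex_bij_betw[OF bij, of "\<lambda>g. ?E $ g $ ?p g"] by simp
    also have "\<dots> = (\<Prod>j\<in>?V. B $ j $ q j)" by (simp add: pf)
    finally show "of_int (sign ?p) * (\<Prod>g\<in>?U. ?E $ g $ ?p g) = of_int (sign q) * (\<Prod>j\<in>?V. B $ j $ q j)"
      using q bij by (simp add: sign_map_permutation bij_betw_def)
  qed
  finally show ?thesis .
qed

text \<open>The blocks are split off one at a time: \<open>E I\<close> has the rows of
  \<open>A\<close> in the blocks of \<open>I\<close> and identity rows elsewhere, and inserting a
  block multiplies it by a single-block matrix.\<close>

lemma det_block_diagonal:
  fixes A :: "'a::comm_ring_1^('i::finite \<times> 'n::finite)^('i \<times> 'n)"
  assumes "\<And>i i' j j'. i \<noteq> i' \<Longrightarrow> A $ (i, j) $ (i', j') = 0"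
  shows "det A = (\<Prod>i\<in>UNIV. det (\<chi> j j'. A $ (i, j) $ (i, j')))"
proof -
  define E :: "'i set \<Rightarrow> 'a^('i \<times> 'n)^('i \<times> 'n)" where
    "E I = (\<chi> g h. if fst g \<in> I then A $ g $ h else if g = h then 1 else 0)" for I
  have "det (E I) = (\<Prod>i\<in>I. det (\<chi> j j'. A $ (i, j) $ (i, j')))" if "finite I" for I
    using that
  proof (induction I rule: finite_induct)
    case empty
    have "E {} = mat 1" by (simp add: E_def mat_def)
    then show ?case by simp
  next
    case (insert i I)
    let ?B = "\<chi> j j'. A $ (i, j) $ (i, j')"
    let ?E = "\<chi> g h. if fst g = i \<and> fst h = i then ?B $ snd g $ snd h
                  else if g = h then 1 else 0 :: 'a^('i \<times> 'n)^('i \<times> 'n)"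
    have "E (insert i I) = E I ** ?E"
    proof (rule vec_eq_iff[THEN iffD2, OF allI], rule vec_eq_iff[THEN iffD2, OF allI])
      fix g h :: "'i \<times> 'n"
      obtain i1 j1 i2 j2 where gh: "g = (i1, j1)" "h = (i2, j2)" by (cases g, cases h)
      have prod: "(E I ** ?E) $ g $ h = (\<Sum>k\<in>UNIV. E I $ g $ k * ?E $ k $ h)"
        by (simp add: matrix_matrix_mult_def)
      \<comment> \<open>If \<open>g\<close> lies in block \<open>i\<close>, row \<open>g\<close> of
        \<open>E I\<close> is an identity row. Otherwise that row vanishes on block
        \<open>i\<close>, the only place where \<open>?E\<close> differs from the identity.\<close>
      show "E (insert i I) $ g $ h = (E I ** ?E) $ g $ h"
      proof (cases "i1 = i")
        case True
        then have "E I $ g $ k * ?E $ k $ h = (if k = g then ?E $ g $ h else 0)" for k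
          using insert.hyps gh by (simp add: E_def)
        then have "(E I ** ?E) $ g $ h = ?E $ g $ h" unfolding prod by simp
        also have "\<dots> = E (insert i I) $ g $ h"
          using True assms[of i i2 j1 j2] gh by (auto simp: E_def)
        finally show ?thesis by simp
      next
        case False
        then have "E I $ g $ k * ?E $ k $ h = (if k = h then E I $ g $ h else 0)" for k
          using assms[of i1 i j1 "snd k"] gh by (cases k) (auto simp: E_def)
        then have "(E I ** ?E) $ g $ h = E I $ g $ h" unfolding prod by simp
        also have "\<dots> = E (insert i I) $ g $ h"
          using False gh by (simp add: E_def)
        finally show ?thesis by simp
      qed
    qed
    then show ?case
      using insert by (simp add: det_mul det_block_single[of i ?B, simplified])
  qed
  from this[of UNIV] show ?thesis by (simp add: E_def vec_lambda_beta)
qed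

subsection \<open>Fourier transform on the Heisenberg group\<close>

text \<open>In the type \<open>3\<close> the simplifier decides equations between numerals but does not reduce them.\<close>

lemma numeral_3_reduce [simp]: "(3 :: 3) = 0" "(4 :: 3) = 1"
  by simp_all

lemma numeral_3_uminus [simp]: "- (1 :: 3) = 2" "- (2 :: 3) = 1"
  by simp_all

section \<open>The cube root of unity and the characters of Z3\<close>

definition omega :: complex where
  "omega = Complex (- 1 / 2) (sqrt 3 / 2)"

lemma omega_square: "omega\<^sup>2 = - 1 - omega"
  by (simp add: omega_def complex_eq_iff power2_eq_square)

lemma omega_mult_omega: "omega * omega = - 1 - omega"
  using omega_square by (simp add: power2_eq_square)

lemma omega_mult_omega_mult: "omega * (omega * x) = - x - omega * x"
  by (simp add: omega_mult_omega algebra_simps flip: mult.assoc)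

lemma cnj_omega: "cnj omega = - 1 - omega"
  by (simp add: omega_def complex_eq_iff)

text \<open>The character sending 1 to \<open>omega\<close>; its value at 2 is written in the basis
  1, \<open>omega\<close>, to which all later simplification reduces.\<close>

definition chi :: "3 \<Rightarrow> complex" where
  "chi u = (if u = 0 then 1 else if u = 1 then omega else - 1 - omega)"

lemma chi_simps [simp]: "chi 0 = 1" "chi 1 = omega" "chi 2 = - 1 - omega"
  by (simp_all add: chi_def)

lemma cases_3: "(u::3) = 0 \<or> u = 1 \<or> u = 2"
  using exhaust_3[of u] by auto

lemma chi_add: "chi (u + v) = chi u * chi v"
  using cases_3[of u] cases_3[of v] by (auto simp: algebra_simps omega_mult_omega)

lemma chi_uminus: "chi (- u) = cnj (chi u)"
  using cases_3[of u] by (auto simp: cnj_omega)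

lemma sum_UNIV_3: "(\<Sum>u\<in>(UNIV :: 3 set). f u) = f 0 + f 1 + f 2"
  by (simp add: sum_3 add_ac)

lemma prod_UNIV_3: "(\<Prod>u\<in>(UNIV :: 3 set). f u) = f 0 * f 1 * f 2"
  unfolding UNIV_3 by (simp add: mult_ac)

lemma sum_chi: "(\<Sum>u\<in>UNIV. chi (d * u)) = (if d = 0 then 3 else 0)"
  using cases_3[of d] by (auto simp: sum_UNIV_3)

lemma sum_triple:
  "(\<Sum>g\<in>(UNIV :: ('a::finite \<times> 'b::finite \<times> 'c::finite) set). f g) =
    (\<Sum>a\<in>UNIV. \<Sum>b\<in>UNIV. \<Sum>c\<in>UNIV. f (a, b, c))"
  by (simp add: sum.cartesian_product flip: UNIV_Times_UNIV)

text \<open>Induced from the character x^a z^c \<mapsto> \<open>chi (k * c + s * a)\<close>, with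
  coset representatives y^r: moving y^r past x^a produces z^(r a), hence the term
  \<open>k * r\<close>.\<close>

definition rho :: "3 \<Rightarrow> 3 \<Rightarrow> 3 \<times> 3 \<times> 3 \<Rightarrow> 3 \<Rightarrow> 3 \<Rightarrow> complex" where
  "rho k s = (\<lambda>(a, b, c) r u. if u = r + b then chi (k * c + a * (s + k * r)) else 0)"

lemma rho_mult:
  "rho k s (g \<otimes>\<^bsub>H3\<^esub> h) r u = (\<Sum>v\<in>UNIV. rho k s g r v * rho k s h v u)"
proof -
  obtain a b c a' b' c' where gh: "g = (a, b, c)" "h = (a', b', c')" by (cases g, cases h)
  have "(\<Sum>v\<in>UNIV. rho k s g r v * rho k s h v u) =
      (\<Sum>v\<in>UNIV. if v = r + b then chi (k * c + a * (s + k * r)) * rho k s h (r + b) u else 0)"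
    by (rule sum.cong) (auto simp: rho_def gh)
  also have "\<dots> = rho k s (g \<otimes>\<^bsub>H3\<^esub> h) r u"
    by (auto simp: rho_def gh mult_H3 algebra_simps simp flip: chi_add)
  finally show ?thesis by simp
qed

lemma of_int_det:
  fixes A :: "int^'n^'n"
  shows "of_int (det A) = (det (\<chi> i j. of_int (A $ i $ j)) :: 'a::comm_ring_1)"
  by (simp add: det_def of_int_sum of_int_prod)

text \<open>Column 0 of each representation suffices: it yields 27 functions on the group, one for
  each \<open>(k, s, r)\<close>.\<close>

definition fourier :: "complex ^ (3 \<times> 3 \<times> 3) ^ (3 \<times> 3 \<times> 3)" where
  "fourier = (\<chi> i g. case i of (k, s, r) \<Rightarrow> rho k s g r 0)"

text \<open>An entry in column 0 is nonzero only for \<open>b = - r\<close>. This leaves the free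
  sums over \<open>a\<close> and \<open>c\<close>, each a character sum over Z3, so the norm is 3
  times 3.\<close>

lemma fourier_orthogonal:
  "fourier ** (\<chi> g i. case i of (k, s, r) \<Rightarrow> cnj (rho k s g r 0)) = mat 9"
proof -
  have "(\<Sum>g\<in>UNIV. rho k s g r 0 * cnj (rho k' s' g r' 0)) =
     (if (k, s, r) = (k', s', r') then 9 else 0)" for k s r k' s' r'
  proof -
    let ?d = "k - k'" and ?e = "s - s' + (k - k') * r"
    have *: "rho k s (a, b, c) r 0 * cnj (rho k' s' (a, b, c) r' 0) =
        (if b = - r then if r = r' then chi (?e * a) * chi (?d * c) else 0 else 0)" for a b c
    proof -
      have "0 = r + b \<longleftrightarrow> b = - r" "0 = r' + b \<longleftrightarrow> b = - r'"
        by (auto simp: eq_neg_iff_add_eq_0 add.commute)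
      then show ?thesis
        by (auto simp: rho_def algebra_simps simp flip: chi_add chi_uminus)
    qed
    have **: "(\<Sum>c\<in>UNIV. rho k s (a, b, c) r 0 * cnj (rho k' s' (a, b, c) r' 0)) =
        (if b = - r then if r = r' then chi (?e * a) * (\<Sum>c\<in>UNIV. chi (?d * c)) else 0 else 0)"
      for a b by (simp add: * sum_distrib_left)
    have "(\<Sum>g\<in>UNIV. rho k s g r 0 * cnj (rho k' s' g r' 0)) =
      (if r = r' then (\<Sum>a\<in>UNIV. chi (?e * a)) * (\<Sum>c\<in>UNIV. chi (?d * c)) else 0)"
      by (simp add: sum_triple ** sum_distrib_right)
    also have "\<dots> = (if (k, s, r) = (k', s', r') then 9 else 0)"
      by (auto simp: sum_chi)
    finally show ?thesis .
  qed
  then show ?thesis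
    by (auto simp: fourier_def vec_eq_iff matrix_matrix_mult_def mat_def)
qed

lemma det_fourier_neq_0: "det fourier \<noteq> 0"
proof
  let ?Q = "\<chi> g i. case i of (k, s, r) \<Rightarrow> cnj (rho k s g r 0)"
  assume "det fourier = 0"
  then have "det (fourier ** ?Q) = 0" by (simp add: det_mul)
  then show False
    unfolding fourier_orthogonal by (subst (asm) det_diagonal) (auto simp: mat_def)
qed

text \<open>The invertible matrix \<open>fourier\<close> intertwines the group matrix with the block
  diagonal matrix \<open>?B\<close>, so the two determinants agree.\<close>

lemma group_det_H3_rho:
  "of_int (group_det H3 a) = (\<Prod>k\<in>UNIV. \<Prod>s\<in>UNIV.
     det (\<chi> r u. \<Sum>g\<in>UNIV. of_int (a g) * rho k s g r u))"
proof -
  interpret H3: group H3 by (rule group_H3)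
  let ?A = "\<chi> g h. of_int (a (g \<otimes>\<^bsub>H3\<^esub> inv\<^bsub>H3\<^esub> h)) :: complex ^ (3 \<times> 3 \<times> 3) ^ (3 \<times> 3 \<times> 3)"
  define m where "m k s r u = (\<Sum>g\<in>UNIV. of_int (a g) * rho k s g r u)" for k s r u
  let ?B = "\<chi> i j. case i of (k, s, r) \<Rightarrow> case j of (k', s', u) \<Rightarrow>
      if k = k' \<and> s = s' then m k s r u else 0 :: complex ^ (3 \<times> 3 \<times> 3) ^ (3 \<times> 3 \<times> 3)"
  \<comment> \<open>Substituting \<open>g h\<close> for \<open>g\<close> turns the sum into the
    coefficients \<open>a g\<close> against \<open>rho\<close> of a product, which multiplicativity
    splits.\<close>
  have shift: "(\<Sum>g\<in>UNIV. rho k s g r 0 * of_int (a (g \<otimes>\<^bsub>H3\<^esub> inv\<^bsub>H3\<^esub> h))) =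
      (\<Sum>u\<in>UNIV. m k s r u * rho k s h u 0)" for k s r h
  proof -
    have "bij_betw (\<lambda>g. g \<otimes>\<^bsub>H3\<^esub> h) UNIV UNIV"
      by (rule bij_betw_byWitness[of _ "\<lambda>g. g \<otimes>\<^bsub>H3\<^esub> inv\<^bsub>H3\<^esub> h"]) (auto simp: H3.m_assoc)
    then have "(\<Sum>g\<in>UNIV. rho k s g r 0 * of_int (a (g \<otimes>\<^bsub>H3\<^esub> inv\<^bsub>H3\<^esub> h))) =
      (\<Sum>g\<in>UNIV. rho k s (g \<otimes>\<^bsub>H3\<^esub> h) r 0 * of_int (a (g \<otimes>\<^bsub>H3\<^esub> h \<otimes>\<^bsub>H3\<^esub> inv\<^bsub>H3\<^esub> h)))"
      by (rule sum.reindex_bij_betw [symmetric])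
    also have "\<dots> = (\<Sum>g\<in>UNIV. \<Sum>u\<in>UNIV. of_int (a g) * rho k s g r u * rho k s h u 0)"
      by (simp add: H3.m_assoc rho_mult sum_distrib_left mult_ac)
    also have "\<dots> = (\<Sum>u\<in>UNIV. m k s r u * rho k s h u 0)"
      by (subst sum.swap) (simp add: m_def sum_distrib_right)
    finally show ?thesis .
  qed
  have "fourier ** ?A = ?B ** fourier"
  proof (rule vec_eq_iff[THEN iffD2, OF allI], rule vec_eq_iff[THEN iffD2, OF allI])
    fix i h :: "3 \<times> 3 \<times> 3"
    obtain k s r where i: "i = (k, s, r)" by (cases i)
    have "(fourier ** ?A) $ i $ h = (\<Sum>u\<in>UNIV. m k s r u * rho k s h u 0)"
      by (simp add: i matrix_matrix_mult_def fourier_def shift)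
    also have "\<dots> = (\<Sum>j\<in>UNIV. ?B $ i $ j * fourier $ j $ h)"
    proof -
      have "(\<Sum>u\<in>UNIV. ?B $ i $ (k', s', u) * fourier $ (k', s', u) $ h) =
          (if s = s' then if k = k' then \<Sum>u\<in>UNIV. m k s r u * rho k s h u 0 else 0 else 0)" for k' s'
        by (simp add: i fourier_def)
      then show ?thesis unfolding sum_triple by simp
    qed
    also have "\<dots> = (?B ** fourier) $ i $ h"
      by (simp only: matrix_matrix_mult_def vec_lambda_beta)
    finally show "(fourier ** ?A) $ i $ h = (?B ** fourier) $ i $ h" .
  qed
  then have "det (fourier ** ?A) = det (?B ** fourier)" by (rule arg_cong)
  then have "det fourier * det ?A = det ?B * det fourier" by (simp only: det_mul)
  moreover have "x = y" if "d * x = y * d" "d \<noteq> 0" for d x y :: complex using that by simp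
  ultimately have "det ?A = det ?B" using det_fourier_neq_0 by blast
  also have "det ?B = (\<Prod>k\<in>UNIV. \<Prod>s\<in>UNIV. det (\<chi> r u. m k s r u))"
    by (simp add: det_block_diagonal)
  finally show ?thesis
    unfolding m_def group_det_def of_int_det by simp
qed

subsection \<open>Nine integers on the affine plane of order 3\<close>

text \<open>The norm of the Eisenstein integer x + y omega + z omega^2.\<close>

definition line_norm :: "int \<Rightarrow> int \<Rightarrow> int \<Rightarrow> int" where
  "line_norm x y z = x\<^sup>2 + y\<^sup>2 + z\<^sup>2 - x * y - x * z - y * z"

definition e2 :: "int \<Rightarrow> int \<Rightarrow> int \<Rightarrow> int" where
  "e2 x y z = x * y + x * z + y * z"

lemma line_norm_e2: "line_norm x y z = (x + y + z)\<^sup>2 - 3 * e2 x y z"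
  by (simp add: line_norm_def e2_def power2_eq_square algebra_simps)

text \<open>Expand in the elementary symmetric functions of \<open>e, f, g, h\<close>: those of
  degree 3 and 4 come with 27 and 81, and the hypotheses handle degrees 1 and 2.\<close>

lemma line_norm_product_cong:
  fixes s E K R e f g h :: int
  assumes "e + f + g + h = 3 * E"
    and "e * f + e * g + e * h + f * g + f * h + g * h = s * K + 3 * R"
  shows "[s * ((s\<^sup>2 - 3 * e) * (s\<^sup>2 - 3 * f) * (s\<^sup>2 - 3 * g) * (s\<^sup>2 - 3 * h))
    = s ^ 9 + 9 * s ^ 6 * (K - s * E)] (mod 27)"
proof -
  have "s * ((s\<^sup>2 - 3 * e) * (s\<^sup>2 - 3 * f) * (s\<^sup>2 - 3 * g) * (s\<^sup>2 - 3 * h)) =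
    s ^ 9 - 3 * s ^ 7 * (e + f + g + h)
    + 9 * s ^ 5 * (e * f + e * g + e * h + f * g + f * h + g * h)
    - 27 * (s ^ 3 * (e * f * g + e * f * h + e * g * h + f * g * h) - 3 * s * e * f * g * h)"
    by algebra
  also have "\<dots> = s ^ 9 + 9 * s ^ 6 * (K - s * E)
    + 27 * (s ^ 5 * R - (s ^ 3 * (e * f * g + e * f * h + e * g * h + f * g * h) - 3 * s * e * f * g * h))"
    unfolding assms by algebra
  finally show ?thesis by (simp add: cong_iff_dvd_diff)
qed

text \<open>
  The point \<open>(i, j)\<close> of the plane carries the variable with subscript \<open>i\<close> and letter \<open>x\<close>, \<open>y\<close> or
  \<open>z\<close> according to \<open>j = 0, 1, 2\<close>; each \<open>line_norm\<close> in \<open>plane_det\<close> belongs to one of the four classes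
  of parallel lines.
\<close>

context
  fixes x0 x1 x2 y0 y1 y2 z0 z1 z2 :: int
begin

definition plane_det :: int where
  "plane_det = (x0 + x1 + x2 + y0 + y1 + y2 + z0 + z1 + z2)
    * (line_norm (x0 + x1 + x2) (y0 + y1 + y2) (z0 + z1 + z2)
     * line_norm (x0 + y0 + z0) (x1 + y1 + z1) (x2 + y2 + z2)
     * line_norm (x0 + y2 + z1) (x1 + y0 + z2) (x2 + y1 + z0)
     * line_norm (x0 + y1 + z2) (x1 + y2 + z0) (x2 + y0 + z1))"

definition plane_lines :: int where
  "plane_lines = x0 * x1 * x2 + y0 * y1 * y2 + z0 * z1 * z2
     + x0 * y0 * z0 + x1 * y1 * z1 + x2 * y2 * z2
     + x0 * y2 * z1 + x1 * y0 * z2 + x2 * y1 * z0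
     + x0 * y1 * z2 + x1 * y2 * z0 + x2 * y0 * z1"

definition plane_cubes :: int where
  "plane_cubes = x0 ^ 3 + x1 ^ 3 + x2 ^ 3 + y0 ^ 3 + y1 ^ 3 + y2 ^ 3 + z0 ^ 3 + z1 ^ 3 + z2 ^ 3"

lemma plane_cong:
  assumes "s = x0 + x1 + x2 + y0 + y1 + y2 + z0 + z1 + z2"
  shows "\<exists>X. plane_cubes - 3 * plane_lines = s ^ 3 + 3 * X \<and>
    [plane_det = s ^ 9 + 9 * s ^ 6 * X] (mod 27)"
proof -
  let ?x = "x0 + x1 + x2" and ?y = "y0 + y1 + y2" and ?z = "z0 + z1 + z2"
  let ?cx = "e2 x0 x1 x2" and ?cy = "e2 y0 y1 y2" and ?cz = "e2 z0 z1 z2"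
  let ?dx = "x0 * x1 * x2" and ?dy = "y0 * y1 * y2" and ?dz = "z0 * z1 * z2"
  let ?e = "e2 ?x ?y ?z"
  let ?f = "e2 (x0 + y0 + z0) (x1 + y1 + z1) (x2 + y2 + z2)"
  let ?g = "e2 (x0 + y2 + z1) (x1 + y0 + z2) (x2 + y1 + z0)"
  let ?h = "e2 (x0 + y1 + z2) (x1 + y2 + z0) (x2 + y0 + z1)"
  \<comment> \<open>\<open>E2\<close>, \<open>E3\<close>, \<open>E4\<close> are the elementary symmetric polynomials of the nine variables, and \<open>F\<close> is the part of
    \<open>E4\<close> belonging to the sets of four points that contain a line.\<close>
  define E2 where "E2 = ?cx + ?cy + ?cz + ?e"
  define E3 where "E3 = ?dx + ?dy + ?dz + ?cx * (?y + ?z) + ?cy * (?x + ?z) + ?cz * (?x + ?y) + ?x * ?y * ?z"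
  define E4 where "E4 = ?dx * (?y + ?z) + ?dy * (?x + ?z) + ?dz * (?x + ?y)
    + e2 ?cx ?cy ?cz + ?cx * ?y * ?z + ?cy * ?x * ?z + ?cz * ?x * ?y"
  define F where "F = ?dx * (?y + ?z) + ?dy * (?x + ?z) + ?dz * (?x + ?y)
     + x0 * y0 * z0 * (s - x0 - y0 - z0) + x1 * y1 * z1 * (s - x1 - y1 - z1) + x2 * y2 * z2 * (s - x2 - y2 - z2)
     + x0 * y2 * z1 * (s - x0 - y2 - z1) + x1 * y0 * z2 * (s - x1 - y0 - z2) + x2 * y1 * z0 * (s - x2 - y1 - z0)
     + x0 * y1 * z2 * (s - x0 - y1 - z2) + x1 * y2 * z0 * (s - x1 - y2 - z0) + x2 * y0 * z1 * (s - x2 - y0 - z1)"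
  let ?K = "E3 - plane_lines"
  \<comment> \<open>Two points lie on exactly one common line, so they are separated in three of the
    four parallel classes.\<close>
  have "?e + ?f + ?g + ?h = 3 * E2"
    unfolding e2_def E2_def by algebra
  moreover have "?e * ?f + ?e * ?g + ?e * ?h + ?f * ?g + ?f * ?h + ?g * ?h = s * ?K + 3 * (E2\<^sup>2 - E4 + F)"
    unfolding e2_def E2_def E3_def E4_def F_def plane_lines_def assms by algebra
  ultimately have "[s * ((s\<^sup>2 - 3 * ?e) * (s\<^sup>2 - 3 * ?f) * (s\<^sup>2 - 3 * ?g) * (s\<^sup>2 - 3 * ?h))
      = s ^ 9 + 9 * s ^ 6 * (?K - s * E2)] (mod 27)"
    by (rule line_norm_product_cong)
  moreover have "plane_det = s * ((s\<^sup>2 - 3 * ?e) * (s\<^sup>2 - 3 * ?f) * (s\<^sup>2 - 3 * ?g) * (s\<^sup>2 - 3 * ?h))"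
    by (simp add: plane_det_def line_norm_e2 assms add_ac)
  \<comment> \<open>Newton's identity: the sum of cubes is
    \<open>s ^ 3 - 3 * s * E2 + 3 * E3\<close>.\<close>
  moreover have "plane_cubes - 3 * plane_lines = s ^ 3 + 3 * (?K - s * E2)"
    unfolding e2_def E2_def E3_def plane_lines_def plane_cubes_def assms by algebra
  ultimately show ?thesis by (intro exI[of _ "?K - s * E2"]) simp
qed

text \<open>For f(T) = u + v T + w T^2 the hypotheses concern f(1) and f'(1). Since (omega - 1)^2 =
  -3 omega, Taylor expansion at 1 shows that 3 divides f(omega), whose norm is
  \<open>line_norm u v w\<close>.\<close>

lemma dvd_9_line_norm:
  fixes u v w :: int
  assumes "3 dvd u + v + w" "3 dvd v + 2 * w"
  shows "9 dvd line_norm u v w"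
proof -
  obtain a b where "u + v + w = 3 * a" "v + 2 * w = 3 * b"
    using assms by (auto elim!: dvdE)
  then have "line_norm u v w = 9 * ((a - b)\<^sup>2 - (a - 2 * b + w) * (b - w))"
    unfolding line_norm_def by algebra
  then show ?thesis by simp
qed

lemma dvd_plane_det:
  assumes "3 dvd x0 + x1 + x2 + y0 + y1 + y2 + z0 + z1 + z2"
  shows "3 ^ 6 dvd plane_det"
proof -
  let ?l1 = "line_norm (x0 + x1 + x2) (y0 + y1 + y2) (z0 + z1 + z2)"
  let ?l2 = "line_norm (x0 + y0 + z0) (x1 + y1 + z1) (x2 + y2 + z2)"
  let ?l3 = "line_norm (x0 + y2 + z1) (x1 + y0 + z2) (x2 + y1 + z0)"
  let ?l4 = "line_norm (x0 + y1 + z2) (x1 + y2 + z0) (x2 + y0 + z1)"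
  have three: "3 dvd line_norm u v w" if "3 dvd u + v + w" for u v w
    using that by (auto simp: line_norm_e2 power2_eq_square)
  have l: "3 dvd ?l1" "3 dvd ?l2" "3 dvd ?l3" "3 dvd ?l4"
    using assms by (auto intro!: three simp: ac_simps)
  \<comment> \<open>Modulo 3 the derivatives v + 2 w of the four classes are q, p, p + q, p + 2 q.
    These are the linear forms over the field of three elements up to scaling, so one of them
    vanishes.\<close>
  let ?p = "x1 + y1 + z1 + 2 * (x2 + y2 + z2)" and ?q = "y0 + y1 + y2 + 2 * (z0 + z1 + z2)"
  have "3 dvd q \<or> 3 dvd p \<or> 3 dvd p + q \<or> 3 dvd p + 2 * q" for p q :: int
    by presburger
  from this[of ?q ?p] have "9 dvd ?l1 \<or> 9 dvd ?l2 \<or> 9 dvd ?l3 \<or> 9 dvd ?l4"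
  proof (elim disjE)
    assume "3 dvd ?q" then have "9 dvd ?l1" using assms by (intro dvd_9_line_norm) (simp_all add: ac_simps)
    then show ?thesis by blast
  next
    assume "3 dvd ?p" then have "9 dvd ?l2" using assms by (intro dvd_9_line_norm) (simp_all add: ac_simps)
    then show ?thesis by blast
  next
    assume "3 dvd ?p + ?q"
    moreover have "x1 + y0 + z2 + 2 * (x2 + y1 + z0) = ?p + ?q - 3 * (z1 + y2 + z2)" by simp
    ultimately have "3 dvd x1 + y0 + z2 + 2 * (x2 + y1 + z0)" by (metis dvd_diff dvd_triv_left)
    then have "9 dvd ?l3" using assms by (intro dvd_9_line_norm) (simp_all add: ac_simps)
    then show ?thesis by blast
  next
    assume "3 dvd ?p + 2 * ?q"
    moreover have "x1 + y2 + z0 + 2 * (x2 + y0 + z1) = ?p + 2 * ?q - 3 * (y1 + y2 + z0 + z1 + 2 * z2)" by simp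
    ultimately have "3 dvd x1 + y2 + z0 + 2 * (x2 + y0 + z1)" by (metis dvd_diff dvd_triv_left)
    then have "9 dvd ?l4" using assms by (intro dvd_9_line_norm) (simp_all add: ac_simps)
    then show ?thesis by blast
  qed
  then have "3 ^ 5 dvd ?l1 * ?l2 * ?l3 * ?l4"
  proof -
    have *: "9 * 3 * 3 * 3 dvd a * b * c * d" if "9 dvd a" "3 dvd b" "3 dvd c" "3 dvd d" for a b c d :: int
      using that by (intro mult_dvd_mono)
    from \<open>9 dvd ?l1 \<or> _\<close> l show ?thesis
      using *[of ?l1 ?l2 ?l3 ?l4] *[of ?l2 ?l1 ?l3 ?l4] *[of ?l3 ?l1 ?l2 ?l4] *[of ?l4 ?l1 ?l2 ?l3]
      by (auto simp: ac_simps)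
  qed
  with assms have "3 * 3 ^ 5 dvd plane_det"
    unfolding plane_det_def by (rule mult_dvd_mono)
  then show ?thesis by simp
qed

end

subsection \<open>The factorization of the group determinant\<close>

text \<open>The cubic form \<open>plane_cubes - 3 * plane_lines\<close> with cube roots of unity
  attached to two of the parallel classes.\<close>

definition twisted_det :: "(3 \<Rightarrow> 3 \<Rightarrow> complex) \<Rightarrow> complex" where
  "twisted_det X = (X 0 0 ^ 3 + X 1 0 ^ 3 + X 2 0 ^ 3 + X 0 1 ^ 3 + X 1 1 ^ 3 + X 2 1 ^ 3
       + X 0 2 ^ 3 + X 1 2 ^ 3 + X 2 2 ^ 3)
     - 3 * (X 0 0 * X 1 0 * X 2 0 + X 0 1 * X 1 1 * X 2 1 + X 0 2 * X 1 2 * X 2 2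
       + X 0 0 * X 0 1 * X 0 2 + X 1 0 * X 1 1 * X 1 2 + X 2 0 * X 2 1 * X 2 2
       + omega * (X 0 0 * X 2 1 * X 1 2 + X 1 0 * X 0 1 * X 2 2 + X 2 0 * X 1 1 * X 0 2)
       + omega\<^sup>2 * (X 0 0 * X 1 1 * X 2 2 + X 1 0 * X 2 1 * X 0 2 + X 2 0 * X 0 1 * X 1 2))"

lemma numeral_3_diff [simp]: "(1::3) - 2 = 2" "(0::3) - 2 = 1" "(0::3) - 1 = 2"
  by simp_all

text \<open>Shifting both indices by \<open>s\<close> permutes rows and columns alike, which
  explains why \<open>s\<close> drops out.\<close>

lemma det_twisted_circulant:
  fixes X :: "3 \<Rightarrow> 3 \<Rightarrow> complex"
  shows "det (\<chi> r u. \<Sum>i\<in>UNIV. X i (u - r) * chi (i * (s + r))) = twisted_det X"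
proof -
  consider "s = 0" | "s = 1" | "s = 2" using cases_3 by blast
  then show ?thesis
    by cases (simp_all add: twisted_det_def det_3 sum_UNIV_3 algebra_simps power2_eq_square
      power3_eq_cube omega_mult_omega omega_mult_omega_mult)
qed

lemma det_circulant:
  fixes Y :: "3 \<Rightarrow> complex"
  shows "det (\<chi> r u. Y (u - r)) = (\<Prod>t\<in>UNIV. \<Sum>j\<in>UNIV. Y j * chi (j * t))"
  by (simp add: det_3 sum_UNIV_3 prod_UNIV_3 algebra_simps power2_eq_square
    power3_eq_cube omega_mult_omega omega_mult_omega_mult)

definition zsum :: "(3 \<times> 3 \<times> 3 \<Rightarrow> int) \<Rightarrow> 3 \<Rightarrow> 3 \<Rightarrow> int" where
  "zsum a i j = (\<Sum>c\<in>UNIV. a (i, j, c))"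

definition zfourier :: "(3 \<times> 3 \<times> 3 \<Rightarrow> int) \<Rightarrow> 3 \<Rightarrow> 3 \<Rightarrow> complex" where
  "zfourier a i j = (\<Sum>c\<in>UNIV. of_int (a (i, j, c)) * chi c)"

abbreviation zsum_det :: "(3 \<times> 3 \<times> 3 \<Rightarrow> int) \<Rightarrow> int" where
  "zsum_det a \<equiv> plane_det (zsum a 0 0) (zsum a 1 0) (zsum a 2 0)
     (zsum a 0 1) (zsum a 1 1) (zsum a 2 1) (zsum a 0 2) (zsum a 1 2) (zsum a 2 2)"

lemma sum_rho:
  "(\<Sum>g\<in>UNIV. of_int (a g) * rho k s g r u) =
    (\<Sum>i\<in>UNIV. (\<Sum>c\<in>UNIV. of_int (a (i, u - r, c)) * chi (k * c)) * chi (i * (s + k * r)))"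
proof -
  have "(\<Sum>c\<in>UNIV. of_int (a (i, j, c)) * rho k s (i, j, c) r u) =
    (if j = u - r then (\<Sum>c\<in>UNIV. of_int (a (i, u - r, c)) * chi (k * c)) * chi (i * (s + k * r)) else 0)" for i j
  proof -
    have "u = r + j \<longleftrightarrow> j = u - r" by (auto simp: algebra_simps)
    then show ?thesis by (auto simp: rho_def chi_add sum_distrib_left mult_ac)
  qed
  then show ?thesis by (simp add: sum_triple)
qed

lemma rho_2_cnj: "rho 2 s g r u = cnj (rho 1 (- s) g r u)"
proof -
  have two: "2 * x = - x" for x :: 3
    using cases_3[of x] by auto
  have "2 * c + b * (s + 2 * r) = - (1 * c + b * (- s + 1 * r))" for b c :: 3
    unfolding two by (simp add: algebra_simps)
  then show ?thesis by (simp only: rho_def chi_uminus split: prod.split) simp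
qed

lemma det_cnj:
  fixes A :: "complex^'n^'n"
  shows "det (\<chi> i j. cnj (A $ i $ j)) = cnj (det A)"
  by (simp add: det_def cnj_sum cnj_prod)

lemma of_int_line_norm:
  "(of_int x + of_int y * omega + of_int z * (- 1 - omega)) *
   (of_int x + of_int y * (- 1 - omega) + of_int z * omega) = complex_of_int (line_norm x y z)"
  by (simp add: line_norm_def algebra_simps power2_eq_square omega_mult_omega omega_mult_omega_mult)

lemma det_rho_0:
  "(\<Prod>s\<in>UNIV. det (\<chi> r u. \<Sum>g\<in>UNIV. of_int (a g) * rho 0 s g r u)) = of_int (zsum_det a)"
proof -
  let ?b = "\<lambda>i j. complex_of_int (zsum a i j)"
  let ?l = "\<lambda>x y z. of_int x + of_int y * omega + of_int z * (- 1 - omega)"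
  let ?l' = "\<lambda>x y z. of_int x + of_int y * (- 1 - omega) + of_int z * omega"
  have "(\<Sum>g\<in>UNIV. of_int (a g) * rho 0 s g r u) = (\<Sum>i\<in>UNIV. ?b i (u - r) * chi (i * s))" for s r u
    by (simp add: sum_rho zsum_def)
  then have "(\<Prod>s\<in>UNIV. det (\<chi> r u. \<Sum>g\<in>UNIV. of_int (a g) * rho 0 s g r u)) =
    (\<Prod>s\<in>UNIV. \<Prod>t\<in>UNIV. \<Sum>j\<in>UNIV. (\<Sum>i\<in>UNIV. ?b i j * chi (i * s)) * chi (j * t))"
    by (simp add: det_circulant[of "\<lambda>j. \<Sum>i\<in>UNIV. ?b i j * chi (i * _)"])
  also have "\<dots> = of_int (zsum_det a)"
  proof -
    define L where "L s t = (\<Sum>j\<in>UNIV. (\<Sum>i\<in>UNIV. ?b i j * chi (i * s)) * chi (j * t))" for s t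
    let ?z = "zsum a"
    note expand = L_def sum_UNIV_3 algebra_simps omega_mult_omega omega_mult_omega_mult
    have L: "L 0 0 = of_int (?z 0 0 + ?z 1 0 + ?z 2 0 + ?z 0 1 + ?z 1 1 + ?z 2 1 + ?z 0 2 + ?z 1 2 + ?z 2 2)"
      "L 0 1 = ?l (?z 0 0 + ?z 1 0 + ?z 2 0) (?z 0 1 + ?z 1 1 + ?z 2 1) (?z 0 2 + ?z 1 2 + ?z 2 2)"
      "L 0 2 = ?l' (?z 0 0 + ?z 1 0 + ?z 2 0) (?z 0 1 + ?z 1 1 + ?z 2 1) (?z 0 2 + ?z 1 2 + ?z 2 2)"
      "L 1 0 = ?l (?z 0 0 + ?z 0 1 + ?z 0 2) (?z 1 0 + ?z 1 1 + ?z 1 2) (?z 2 0 + ?z 2 1 + ?z 2 2)"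
      "L 2 0 = ?l' (?z 0 0 + ?z 0 1 + ?z 0 2) (?z 1 0 + ?z 1 1 + ?z 1 2) (?z 2 0 + ?z 2 1 + ?z 2 2)"
      "L 1 1 = ?l (?z 0 0 + ?z 2 1 + ?z 1 2) (?z 1 0 + ?z 0 1 + ?z 2 2) (?z 2 0 + ?z 1 1 + ?z 0 2)"
      "L 2 2 = ?l' (?z 0 0 + ?z 2 1 + ?z 1 2) (?z 1 0 + ?z 0 1 + ?z 2 2) (?z 2 0 + ?z 1 1 + ?z 0 2)"
      "L 1 2 = ?l (?z 0 0 + ?z 1 1 + ?z 2 2) (?z 1 0 + ?z 2 1 + ?z 0 2) (?z 2 0 + ?z 0 1 + ?z 1 2)"
      "L 2 1 = ?l' (?z 0 0 + ?z 1 1 + ?z 2 2) (?z 1 0 + ?z 2 1 + ?z 0 2) (?z 2 0 + ?z 0 1 + ?z 1 2)"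
      by (simp_all add: expand)
    \<comment> \<open>The trivial character stands alone; the other eight pair up with their
      conjugates, one pair for each parallel class.\<close>
    have "(\<Prod>s\<in>UNIV. \<Prod>t\<in>UNIV. L s t) =
        L 0 0 * (L 0 1 * L 0 2 * (L 1 0 * L 2 0) * (L 1 1 * L 2 2) * (L 1 2 * L 2 1))"
      by (simp add: prod_UNIV_3 mult_ac)
    also have "\<dots> = of_int (zsum_det a)"
      unfolding L of_int_line_norm plane_det_def by simp
    finally show ?thesis unfolding L_def .
  qed
  finally show ?thesis .
qed

lemma det_rho_1:
  "det (\<chi> r u. \<Sum>g\<in>UNIV. of_int (a g) * rho 1 s g r u) = twisted_det (zfourier a)"
  by (simp add: sum_rho zfourier_def flip: det_twisted_circulant[of "zfourier a" s])

lemma det_rho_2: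
  "det (\<chi> r u. \<Sum>g\<in>UNIV. of_int (a g) * rho 2 s g r u) = cnj (twisted_det (zfourier a))"
  unfolding det_rho_1[of a "- s", symmetric] det_cnj[symmetric]
  by (simp add: rho_2_cnj)

lemma group_det_H3:
  "of_int (group_det H3 a) = of_int (zsum_det a) * (twisted_det (zfourier a) * cnj (twisted_det (zfourier a))) ^ 3"
  \<comment> \<open>Only the product over \<open>k\<close> is expanded: \<open>det_rho_0\<close>
    needs the whole product over \<open>s\<close>, while for \<open>k\<close> = 1, 2 its three
    factors are equal, whence the cube.\<close>
  unfolding group_det_H3_rho prod_UNIV_3[of "\<lambda>k. \<Prod>s\<in>UNIV. _ k s"]
  by (simp add: det_rho_0 det_rho_1 det_rho_2 power_mult_distrib)

subsection \<open>Congruences of Eisenstein integers\<close>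

definition eisenstein :: "complex set" where
  "eisenstein = {of_int p + of_int q * omega | p q. True}"

lemma eisensteinI: "of_int p + of_int q * omega \<in> eisenstein"
  by (auto simp: eisenstein_def)

lemma eisenstein_of_int [intro, simp]: "of_int p \<in> eisenstein"
  using eisensteinI[of p 0] by simp

lemma eisenstein_numeral [intro, simp]: "0 \<in> eisenstein" "1 \<in> eisenstein" "numeral n \<in> eisenstein"
  using eisenstein_of_int[of 0] eisenstein_of_int[of 1] eisenstein_of_int[of "numeral n"] by simp_all

lemma eisenstein_omega [intro, simp]: "omega \<in> eisenstein"
  using eisensteinI[of 0 1] by simp

lemma eisenstein_add [intro, simp]:
  assumes "x \<in> eisenstein" "y \<in> eisenstein"
  shows "x + y \<in> eisenstein"
proof -
  from assms obtain p q r s where "x = of_int p + of_int q * omega" "y = of_int r + of_int s * omega"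
    by (auto simp: eisenstein_def)
  then show ?thesis using eisensteinI[of "p + r" "q + s"] by (simp add: algebra_simps)
qed

lemma eisenstein_mult [intro, simp]:
  assumes "x \<in> eisenstein" "y \<in> eisenstein"
  shows "x * y \<in> eisenstein"
proof -
  from assms obtain p q r s where "x = of_int p + of_int q * omega" "y = of_int r + of_int s * omega"
    by (auto simp: eisenstein_def)
  then show ?thesis using eisensteinI[of "p * r - q * s" "p * s + q * r - q * s"]
    by (simp add: algebra_simps omega_mult_omega omega_mult_omega_mult)
qed

lemma eisenstein_uminus [intro, simp]: "x \<in> eisenstein \<Longrightarrow> - x \<in> eisenstein"
  using eisenstein_mult[OF eisenstein_of_int[of "- 1"]] by simp

lemma eisenstein_diff [intro, simp]: "x \<in> eisenstein \<Longrightarrow> y \<in> eisenstein \<Longrightarrow> x - y \<in> eisenstein"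
  using eisenstein_add[of x "- y"] by simp

lemma eisenstein_power [intro, simp]: "x \<in> eisenstein \<Longrightarrow> x ^ n \<in> eisenstein"
  by (induction n) auto

text \<open>Membership of the right-hand side is built in, so that most congruence rules need no
  separate membership hypotheses.\<close>

definition eis_cong :: "complex \<Rightarrow> complex \<Rightarrow> complex \<Rightarrow> bool" where
  "eis_cong m x y \<longleftrightarrow> y \<in> eisenstein \<and> (\<exists>w\<in>eisenstein. x = y + m * w)"

lemma eis_congI: "x = y + m * w \<Longrightarrow> y \<in> eisenstein \<Longrightarrow> w \<in> eisenstein \<Longrightarrow> eis_cong m x y"
  by (auto simp: eis_cong_def)

lemma eis_congE:
  assumes "eis_cong m x y"
  obtains w where "x = y + m * w" "y \<in> eisenstein" "w \<in> eisenstein"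
  using assms by (auto simp: eis_cong_def)

lemma eis_cong_refl: "x \<in> eisenstein \<Longrightarrow> eis_cong m x x"
  by (rule eis_congI[of _ _ _ 0]) auto

lemma eis_cong_add:
  assumes "eis_cong m x y" "eis_cong m x' y'"
  shows "eis_cong m (x + x') (y + y')"
proof -
  from assms obtain v w where "x = y + m * v" "x' = y' + m * w"
    and E: "y \<in> eisenstein" "y' \<in> eisenstein" "v \<in> eisenstein" "w \<in> eisenstein"
    by (elim eis_congE)
  then have "x + x' = y + y' + m * (v + w)" by (simp add: algebra_simps)
  then show ?thesis by (rule eis_congI) (use E in auto)
qed

lemma eis_cong_diff:
  assumes "eis_cong m x y" "eis_cong m x' y'"
  shows "eis_cong m (x - x') (y - y')"
proof -
  from assms obtain v w where "x = y + m * v" "x' = y' + m * w"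
    and E: "y \<in> eisenstein" "y' \<in> eisenstein" "v \<in> eisenstein" "w \<in> eisenstein"
    by (elim eis_congE)
  then have "x - x' = y - y' + m * (v - w)" by (simp add: algebra_simps)
  then show ?thesis by (rule eis_congI) (use E in auto)
qed

lemma eis_cong_mult:
  assumes "eis_cong m x y" "eis_cong m x' y'" "m \<in> eisenstein"
  shows "eis_cong m (x * x') (y * y')"
proof -
  from assms(1,2) obtain v w where "x = y + m * v" "x' = y' + m * w"
    and E: "y \<in> eisenstein" "y' \<in> eisenstein" "v \<in> eisenstein" "w \<in> eisenstein"
    by (elim eis_congE)
  then have "x * x' = y * y' + m * (y * w + v * y' + m * v * w)"
    by (simp add: algebra_simps)
  then show ?thesis by (rule eis_congI) (use E assms(3) in auto)
qed

lemma eis_cong_3_mult: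
  assumes "eis_cong m x y"
  shows "eis_cong (3 * m) (3 * x) (3 * y)"
proof -
  from assms obtain w where "x = y + m * w" and E: "y \<in> eisenstein" "w \<in> eisenstein"
    by (elim eis_congE)
  then have "3 * x = 3 * y + 3 * m * w" by (simp add: algebra_simps)
  then show ?thesis by (rule eis_congI) (use E in auto)
qed

abbreviation prime_3 :: complex where "prime_3 \<equiv> 1 - omega"

lemma eis_cong_omega:
  "eis_cong prime_3 omega 1" "eis_cong prime_3 (omega\<^sup>2) 1" "eis_cong prime_3 (- 1 - omega) 1"
  by (rule eis_congI[of _ _ _ "- 1"], simp_all)
    (rule eis_congI[of _ _ _ "- 1 - omega"],
      simp_all add: algebra_simps omega_mult_omega power2_eq_square)+

text \<open>The mixed terms of the binomial carry \<open>3 * prime_3\<close>, and so does the last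
  one, because \<open>prime_3 ^ 3 = - 3 * omega * prime_3\<close>.\<close>

lemma eis_cong_cube:
  assumes "eis_cong prime_3 x y"
  shows "eis_cong (3 * prime_3) (x ^ 3) (y ^ 3)"
proof -
  from assms obtain w where w: "x = y + prime_3 * w" "y \<in> eisenstein" "w \<in> eisenstein"
    by (elim eis_congE)
  have "x ^ 3 = y ^ 3 + 3 * prime_3 * (y\<^sup>2 * w + prime_3 * y * w\<^sup>2 - omega * w ^ 3)"
    unfolding w(1) by (simp add: power2_eq_square power3_eq_cube algebra_simps omega_mult_omega omega_mult_omega_mult)
  then show ?thesis by (rule eis_congI) (use w in auto)
qed

text \<open>The cubes gain a factor 3 by \<open>eis_cong_cube\<close>; the line products already
  carry one, and \<open>omega\<close> is 1 modulo \<open>prime_3\<close>.\<close>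

lemma twisted_det_eis_cong:
  assumes "\<And>i j. eis_cong prime_3 (X i j) (of_int (b i j))"
  shows "eis_cong (3 * prime_3) (twisted_det X) (of_int
    (plane_cubes (b 0 0) (b 1 0) (b 2 0) (b 0 1) (b 1 1) (b 2 1) (b 0 2) (b 1 2) (b 2 2)
     - 3 * plane_lines (b 0 0) (b 1 0) (b 2 0) (b 0 1) (b 1 1) (b 2 1) (b 0 2) (b 1 2) (b 2 2)))"
proof -
  define Y where "Y i j = complex_of_int (b i j)" for i j
  have "eis_cong (3 * prime_3) (twisted_det X)
    ((Y 0 0 ^ 3 + Y 1 0 ^ 3 + Y 2 0 ^ 3 + Y 0 1 ^ 3 + Y 1 1 ^ 3 + Y 2 1 ^ 3
       + Y 0 2 ^ 3 + Y 1 2 ^ 3 + Y 2 2 ^ 3)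
     - 3 * (Y 0 0 * Y 1 0 * Y 2 0 + Y 0 1 * Y 1 1 * Y 2 1 + Y 0 2 * Y 1 2 * Y 2 2
       + Y 0 0 * Y 0 1 * Y 0 2 + Y 1 0 * Y 1 1 * Y 1 2 + Y 2 0 * Y 2 1 * Y 2 2
       + 1 * (Y 0 0 * Y 2 1 * Y 1 2 + Y 1 0 * Y 0 1 * Y 2 2 + Y 2 0 * Y 1 1 * Y 0 2)
       + 1 * (Y 0 0 * Y 1 1 * Y 2 2 + Y 1 0 * Y 2 1 * Y 0 2 + Y 2 0 * Y 0 1 * Y 1 2)))"
    unfolding twisted_det_def
    by (intro eis_cong_diff eis_cong_add eis_cong_3_mult eis_cong_mult eis_cong_cube eis_cong_omega)
      (auto simp: Y_def intro: assms)
  then show ?thesis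
    by (simp add: plane_cubes_def plane_lines_def Y_def algebra_simps)
qed

lemma eisenstein_norm:
  "(of_int p + of_int q * omega) * cnj (of_int p + of_int q * omega) = of_int (p\<^sup>2 - p * q + q\<^sup>2)"
  by (simp add: cnj_omega algebra_simps power2_eq_square omega_mult_omega omega_mult_omega_mult)

text \<open>For x = n + 3 t the norm is n^2 + 3 n Tr(t) + 9 N(t), and 3 divides the trace of any
  multiple t of \<open>prime_3\<close>.\<close>

lemma eis_cong_norm:
  assumes "eis_cong (3 * prime_3) x (of_int n)"
  obtains M where "x * cnj x = of_int M" "[M = n\<^sup>2] (mod 9)"
proof -
  from assms obtain p q where pq: "x = of_int n + 3 * prime_3 * (of_int p + of_int q * omega)"
    by (auto simp: eis_cong_def eisenstein_def)
  have x: "x = of_int (n + 3 * (p + q)) + of_int (3 * (2 * q - p)) * omega"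
    unfolding pq by (simp add: algebra_simps omega_mult_omega omega_mult_omega_mult)
  let ?M = "(n + 3 * (p + q))\<^sup>2 - (n + 3 * (p + q)) * (3 * (2 * q - p)) + (3 * (2 * q - p))\<^sup>2"
  have "?M = n\<^sup>2 + 9 * (n * p + (p + q)\<^sup>2 - (p + q) * (2 * q - p) + (2 * q - p)\<^sup>2)"
    by algebra
  then have "[?M = n\<^sup>2] (mod 9)" by (simp add: cong_iff_dvd_diff)
  moreover have "x * cnj x = of_int ?M" unfolding x by (rule eisenstein_norm)
  ultimately show ?thesis by (rule that[rotated])
qed

lemma zfourier_cong: "eis_cong prime_3 (zfourier a i j) (of_int (zsum a i j))"
proof -
  have "eis_cong prime_3 (zfourier a i j)
      (of_int (a (i, j, 0)) * 1 + of_int (a (i, j, 1)) * 1 + of_int (a (i, j, 2)) * 1)"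
    unfolding zfourier_def sum_UNIV_3 chi_simps
    by (intro eis_cong_add eis_cong_mult eis_cong_omega eis_cong_refl) auto
  then show ?thesis by (simp add: zsum_def sum_UNIV_3)
qed

section \<open>Residues of the group determinant modulo 27 and divisibility by 3^12\<close>

lemma power_6_cong:
  fixes s X M :: int
  assumes "[M = (s ^ 3 + 3 * X)\<^sup>2] (mod 9)"
  shows "[M ^ 3 = s ^ 18 + 18 * s ^ 15 * X] (mod 27)"
proof -
  obtain t where M: "M = (s ^ 3 + 3 * X)\<^sup>2 + 9 * t"
    using assms by (metis cong_iff_lin cong_sym)
  let ?n = "s ^ 3 + 3 * X"
  \<comment> \<open>From X^2 on, the sixth power has coefficients divisible by 27 (the first is 15 *
    9); cubing turns the error \<open>9 * t\<close> into a multiple of 27.\<close>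
  have "M ^ 3 = s ^ 18 + 18 * s ^ 15 * X + 27 * (5 * s ^ 12 * X\<^sup>2 + 20 * s ^ 9 * X ^ 3
     + 45 * s ^ 6 * X ^ 4 + 54 * s ^ 3 * X ^ 5 + 27 * X ^ 6
     + ?n ^ 4 * t + 9 * ?n\<^sup>2 * t\<^sup>2 + 27 * t ^ 3)"
    unfolding M by algebra
  then show ?thesis by (simp add: cong_iff_dvd_diff)
qed

text \<open>In (e + c k)^3 the middle terms carry 3 c, and c^3 is a multiple of 3 c because 3
  divides c.\<close>

lemma cong_cube:
  fixes x e c :: int
  assumes "[x = e] (mod c)" "3 dvd c" "e ^ 3 = e"
  shows "[x ^ 3 = e] (mod 3 * c)"
proof -
  obtain d where d: "c = 3 * d" using assms(2) by blast
  obtain k where x: "x = e + c * k" using assms(1) by (metis cong_iff_lin cong_sym)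
  have "x ^ 3 = e ^ 3 + 3 * c * (e\<^sup>2 * k + e * c * k\<^sup>2 + d * c * k ^ 3)"
    unfolding x d by algebra
  then show ?thesis by (simp add: assms(3) cong_iff_dvd_diff)
qed

lemma group_det_H3_cases:
  "[group_det H3 a = 1] (mod 27) \<or> [group_det H3 a = - 1] (mod 27) \<or> 3 ^ 12 dvd group_det H3 a"
proof -
  let ?D = "group_det H3 a"
  let ?z = "zsum a"
  define s where "s = ?z 0 0 + ?z 1 0 + ?z 2 0 + ?z 0 1 + ?z 1 1 + ?z 2 1 + ?z 0 2 + ?z 1 2 + ?z 2 2"
  from twisted_det_eis_cong[of "zfourier a" "zsum a", OF zfourier_cong] obtain M
    where twisted_det: "twisted_det (zfourier a) * cnj (twisted_det (zfourier a)) = of_int M"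
    and M: "[M = (plane_cubes (?z 0 0) (?z 1 0) (?z 2 0) (?z 0 1) (?z 1 1) (?z 2 1) (?z 0 2) (?z 1 2) (?z 2 2)
     - 3 * plane_lines (?z 0 0) (?z 1 0) (?z 2 0) (?z 0 1) (?z 1 1) (?z 2 1) (?z 0 2) (?z 1 2) (?z 2 2))\<^sup>2] (mod 9)"
    by (rule eis_cong_norm)
  have "of_int (?D) = complex_of_int (zsum_det a * M ^ 3)"
    by (simp add: group_det_H3 twisted_det)
  then have D: "?D = zsum_det a * M ^ 3" by (simp only: of_int_eq_iff)
  obtain X where X: "[M = (s ^ 3 + 3 * X)\<^sup>2] (mod 9)"
    and P: "[zsum_det a = s ^ 9 + 9 * s ^ 6 * X] (mod 27)"
    using plane_cong[OF s_def] M by metis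
  show ?thesis
  proof (cases "3 dvd s")
    case True
    then have "3 ^ 6 dvd zsum_det a" unfolding s_def by (rule dvd_plane_det)
    moreover have "9 dvd M"
    proof -
      from True obtain r where "s = 3 * r" by blast
      then have "(s ^ 3 + 3 * X)\<^sup>2 = 9 * (9 * r ^ 3 + X)\<^sup>2" by algebra
      with X show ?thesis by (metis cong_dvd_iff dvd_triv_left)
    qed
    then have "9 ^ 3 dvd M ^ 3" by (rule dvd_power_same)
    ultimately have "3 ^ 6 * 9 ^ 3 dvd ?D" unfolding D by (rule mult_dvd_mono)
    then show ?thesis by simp
  next
    case False
    have "[?D = (s ^ 9 + 9 * s ^ 6 * X) * (s ^ 18 + 18 * s ^ 15 * X)] (mod 27)"
      unfolding D by (intro cong_mult P power_6_cong X)
    \<comment> \<open>The terms linear in \<open>X\<close> have coefficients 9 and 18, which add up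
      to 27, so the unknown \<open>X\<close> disappears.\<close>
    also have "(s ^ 9 + 9 * s ^ 6 * X) * (s ^ 18 + 18 * s ^ 15 * X)
       = s ^ 27 + 27 * (s ^ 24 * X + 6 * s ^ 21 * X\<^sup>2)" by algebra
    also have "[\<dots> = s ^ 27] (mod 27)" by (simp add: cong_iff_dvd_diff)
    finally have "[?D = s ^ 27] (mod 27)" .
    moreover have "\<exists>e\<in>{1, - 1}. [s ^ 27 = e] (mod 27)"
    proof -
      have "\<exists>e\<in>{1, - 1}. [s = e] (mod 3)"
        using False by (simp add: cong_iff_dvd_diff) presburger
      then obtain e where e: "e \<in> {1, - 1}" "[s = e] (mod 3)" by blast
      then have "e ^ 3 = e" by auto
      \<comment> \<open>Three cubings lift the modulus from 3 to 81, which is then weakened to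
        27.\<close>
      then have "[((s ^ 3) ^ 3) ^ 3 = e] (mod 3 * (3 * (3 * 3)))"
        using e(2) by (intro cong_cube) simp_all
      then have "[s ^ 27 = e] (mod 27)"
        by (simp flip: power_mult) (rule cong_dvd_modulus, auto)
      with e(1) show ?thesis by blast
    qed
    ultimately show ?thesis by (auto intro: cong_trans)
  qed
qed

subsection \<open>Realizing the values\<close>

lemma group_det_H3_eqI:
  assumes "twisted_det (zfourier a) = of_int p + of_int q * omega"
  shows "group_det H3 a = zsum_det a * (p\<^sup>2 - p * q + q\<^sup>2) ^ 3"
proof -
  have "complex_of_int (group_det H3 a) = of_int (zsum_det a * (p\<^sup>2 - p * q + q\<^sup>2) ^ 3)"
    by (simp only: group_det_H3 assms eisenstein_norm of_int_mult of_int_power)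
  then show ?thesis by (simp only: of_int_eq_iff)
qed

lemma group_det_uminus: "group_det H3 (\<lambda>g. - a g) = - group_det H3 a"
proof -
  have "zfourier (\<lambda>g. - a g) = (\<lambda>i j. - zfourier a i j)" "zsum (\<lambda>g. - a g) = (\<lambda>i j. - zsum a i j)"
    by (simp_all add: zfourier_def zsum_def sum_negf fun_eq_iff)
  moreover have "twisted_det (\<lambda>i j. - X i j) = - twisted_det X" for X
    by (simp add: twisted_det_def algebra_simps)
  moreover have "line_norm (- x - y - z) (- u - v - w) (- x' - y' - z') = line_norm (x + y + z) (u + v + w) (x' + y' + z')"
    for x y z u v w x' y' z' by (simp add: line_norm_def power2_eq_square algebra_simps)
  ultimately have "complex_of_int (group_det H3 (\<lambda>g. - a g)) = of_int (- group_det H3 a)"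
    by (simp add: group_det_H3 plane_det_def algebra_simps)
  then show ?thesis by (simp only: of_int_eq_iff)
qed

text \<open>The constant \<open>m\<close> is seen only by the trivial character: it leaves
  \<open>zfourier\<close> and the line norms unchanged and adds 27 m to the coefficient sum.\<close>

definition signed_indicator :: "'g set \<Rightarrow> 'g set \<Rightarrow> int \<Rightarrow> 'g \<Rightarrow> int" where
  "signed_indicator A B m g = m + of_bool (g \<in> A) - of_bool (g \<in> B)"

lemma zfourier_signed_indicator:
  "zfourier (signed_indicator A B m) i j = (\<Sum>c\<in>UNIV. (of_bool ((i, j, c) \<in> A) - of_bool ((i, j, c) \<in> B)) * chi c)"
  by (simp add: zfourier_def signed_indicator_def sum_UNIV_3 algebra_simps)

lemma zsum_signed_indicator:
  "zsum (signed_indicator A B m) i j = 3 * m + (\<Sum>c\<in>UNIV. of_bool ((i, j, c) \<in> A) - of_bool ((i, j, c) \<in> B))"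
  by (simp add: zsum_def signed_indicator_def sum_UNIV_3 algebra_simps)

lemmas evaluate = zfourier_signed_indicator zsum_signed_indicator sum_UNIV_3
  twisted_det_def plane_det_def line_norm_def power2_eq_square power3_eq_cube algebra_simps
  omega_mult_omega omega_mult_omega_mult

lemma group_det_unit: "group_det H3 (signed_indicator {(0, 0, 0)} {} m) = 1 + 27 * m"
  by (subst group_det_H3_eqI[of _ 1 0]; simp add: evaluate)

text \<open>
  The following five elements come from a computer search.  Up to sign \<open>9 * m + t\<close> with
  \<open>0 \<le> t \<le> 4\<close> covers all integers.
\<close>

lemma group_det_multiple_0:
  "group_det H3 (signed_indicator {(0, 1, 0), (0, 2, 0)} {(0, 0, 2), (2, 1, 0)} m)
    = 3 ^ 12 * (9 * m + 0)"
  \<comment> \<open>The arguments are the coordinates of the twisted determinant. In all five cases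
    its norm is 9, the line norms multiply to 3^5, and the coefficient sum is 3 (9 m + t).\<close>
  by (subst group_det_H3_eqI[of _ "- 3" "- 3"]) (simp_all add: evaluate)

lemma group_det_multiple_1:
  "group_det H3 (signed_indicator {(0, 0, 0), (1, 1, 0), (1, 2, 0), (2, 0, 2)} {(0, 2, 2)} m)
    = 3 ^ 12 * (9 * m + 1)"
  by (subst group_det_H3_eqI[of _ 0 "- 3"]) (simp_all add: evaluate)

lemma group_det_multiple_2:
  "group_det H3 (signed_indicator {(0, 2, 1), (0, 2, 2), (1, 0, 1), (1, 1, 0), (1, 2, 1), (2, 1, 2)} {} m)
    = 3 ^ 12 * (9 * m + 2)"
  by (subst group_det_H3_eqI[of _ 3 0]) (simp_all add: evaluate)

lemma group_det_multiple_3: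
  "group_det H3 (signed_indicator {(0, 0, 1), (0, 1, 1), (1, 0, 0), (1, 1, 0), (1, 2, 0),
    (2, 1, 0), (2, 1, 1), (2, 2, 1), (2, 2, 2)} {} m)
    = 3 ^ 12 * (9 * m + 3)"
  by (subst group_det_H3_eqI[of _ 3 0]) (simp_all add: evaluate)

lemma group_det_multiple_4:
  "group_det H3 (signed_indicator {(0, 1, 0), (0, 1, 1), (0, 2, 2), (1, 0, 2), (1, 1, 0), (1, 1, 1),
    (1, 2, 0), (2, 0, 0), (2, 0, 2), (2, 1, 0), (2, 2, 1), (2, 2, 2)} {} m)
    = 3 ^ 12 * (9 * m + 4)"
  by (subst group_det_H3_eqI[of _ "- 3" 0]) (simp_all add: evaluate)

lemmas group_det_multiples = group_det_multiple_0 group_det_multiple_1 group_det_multiple_2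
  group_det_multiple_3 group_det_multiple_4

theorem theorem5:
  shows "S1 H3 = {m :: int. [m = 1] (mod 27) \<or> [m = - 1] (mod 27)}
    \<and> S0 H3 = {3 ^ 12 * k | k :: int. True}"
proof -
  have dets: "group_det H3 a \<in> integer_group_dets H3" "- group_det H3 a \<in> integer_group_dets H3" for a
    unfolding integer_group_dets_def group_det_uminus[symmetric] by blast+
  have lin: "\<exists>k. m = 1 + 27 * k \<or> m = - (1 + 27 * k)"
    if m: "[m = 1] (mod 27) \<or> [m = - 1] (mod 27)" for m :: int
  proof -
    obtain k where "m = 1 + 27 * k \<or> m = - 1 + 27 * k"
      using m cong_sym cong_iff_lin by metis
    then have "m = 1 + 27 * k \<or> m = - (1 + 27 * (- k))" by auto
    then show ?thesis by blast
  qed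
  have unit: "m \<in> integer_group_dets H3" if "[m = 1] (mod 27) \<or> [m = - 1] (mod 27)" for m
    using lin[OF that] dets group_det_unit by metis
  have small: "3 ^ 12 * j \<in> integer_group_dets H3 \<and> - (3 ^ 12 * j) \<in> integer_group_dets H3"
    if "j mod 9 \<le> 4" for j :: int
  proof -
    define m where "m = j div 9"
    have j: "j = 9 * m + j mod 9" by (simp add: m_def)
    have "0 \<le> j mod 9" by simp
    with that have "j mod 9 \<in> {0, 1, 2, 3, 4}" by auto
    then have "j \<in> {9 * m + 0, 9 * m + 1, 9 * m + 2, 9 * m + 3, 9 * m + 4}"
      using j by auto
    then have "\<exists>a. group_det H3 a = 3 ^ 12 * j"
      using group_det_multiples by blast
    then show ?thesis using dets by metis
  qed
  have multiple: "3 ^ 12 * k \<in> integer_group_dets H3" for k :: int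
  proof (cases "k mod 9 \<le> 4")
    case False
    \<comment> \<open>The residues 5 to 8 are the negatives of 4 to 1.\<close>
    then have "(- k) mod 9 \<le> 4" by presburger
    from small[OF this] show ?thesis by simp
  qed (use small in blast)
  have not_3: "\<not> 3 dvd m" if "[m = 1] (mod 27) \<or> [m = - 1] (mod 27)" for m :: int
    using lin[OF that] by presburger
  have cases: "[m = 1] (mod 27) \<or> [m = - 1] (mod 27) \<or> 3 ^ 12 dvd m"
    if "m \<in> integer_group_dets H3" for m
    using that group_det_H3_cases by (auto simp: integer_group_dets_def)
  have "S1 H3 = {m :: int. [m = 1] (mod 27) \<or> [m = - 1] (mod 27)}"
  proof (intro Set.set_eqI iffI)
    fix m assume "m \<in> S1 H3"
    then have m: "m \<in> integer_group_dets H3" "\<not> 3 dvd m" by (auto simp: S1_def)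
    have "\<not> 3 ^ 12 dvd m" using m(2) by (metis dvd_power dvd_trans zero_less_numeral)
    then show "m \<in> {m. [m = 1] (mod 27) \<or> [m = - 1] (mod 27)}" using cases[OF m(1)] by blast
  next
    fix m :: int assume "m \<in> {m. [m = 1] (mod 27) \<or> [m = - 1] (mod 27)}"
    then show "m \<in> S1 H3" using unit not_3 unfolding S1_def by blast
  qed
  moreover have "S0 H3 = {3 ^ 12 * k | k :: int. True}"
  proof (intro Set.set_eqI iffI)
    fix m assume "m \<in> S0 H3"
    then have "3 ^ 12 dvd m" using cases not_3 unfolding S0_def by blast
    then show "m \<in> {3 ^ 12 * k | k :: int. True}" by (auto elim: dvdE)
  next
    fix m :: int assume "m \<in> {3 ^ 12 * k | k :: int. True}"
    then obtain k where "m = 3 ^ 12 * k" by blast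
    then show "m \<in> S0 H3" using multiple[of k] by (simp add: S0_def)
  qed
  ultimately show ?thesis by blast
qed

end
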